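(* Suppose that $$\frac1n\sum_{\ell=1}^L\sum_{i\in I_\ell}\left[g(W_i,\hat\gamma_\ell,\theta_0)+\phi(W_i,\hat\gamma_\ell,\alpha_0,\theta_0)\right]=\frac1n\sum_{i=1}^n\psi(W_i,\gamma_0,\alpha_0,\theta_0)+o_p(n^{-1/2}).$$ Let $\hat g(\theta_0)=\frac1n\sum_{\ell=1}^L\sum_{i\in I_\ell}g(W_i,\hat\gamma_\ell,\theta_0)$ and $\tilde\phi=\frac1n\sum_{\ell=1}^L\sum_{i\in I_\ell}\phi(W_i,\hat\gamma_\ell,\alpha_0,\theta_0)$. Then $$\hat g(\theta_0)=\frac1n\sum_{i=1}^n\psi(W_i,\gamma_0,\alpha_0,\theta_0)+o_p(n^{-1/2})$$ if and only if $\tilde\phi=o_p(n^{-1/2})$.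
   Context: $W_1,\dots,W_n$ are i.i.d. observations. The indices $\{1,\dots,n\}$ are partitioned into $L$ groups $I_1,\dots,I_L$ and $\hat\gamma_\ell$ is an estimator of the function $\gamma_0$ constructed from the observations not in $I_\ell$. $g(w,\gamma,\theta)$ (identifying moment functions) and $\phi(w,\gamma,\alpha,\theta)$ (nonparametric influence function) are finite dimensional vectors of functions, $\psi(w,\gamma,\alpha,\theta)=g(w,\gamma,\theta)+\phi(w,\gamma,\alpha,\theta)$, and $\gamma_0,\alpha_0,\theta_0$ are the true values. *)

theory Defs
  imports "HOL-Probability.Probability"
begin

definition iid_observations :: "'o measure \<Rightarrow> 'w measure \<Rightarrow> (nat \<Rightarrow> 'o \<Rightarrow> 'w) \<Rightarrow> bool" where
  "iid_observations M S W \<longleftrightarrow>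
     prob_space.indep_vars M (\<lambda>_. S) W {1..} \<and>
     (\<forall>i\<in>{1..}. \<forall>j\<in>{1..}. distr M S (W i) = distr M S (W j))"

(* Individual groups may be empty: for n < L they cannot all be nonempty. *)
definition partition_into_groups :: "nat \<Rightarrow> nat \<Rightarrow> (nat \<Rightarrow> nat set) \<Rightarrow> bool" where
  "partition_into_groups n L I \<longleftrightarrow>
     disjoint_family_on I {1..L} \<and> (\<Union>l\<in>{1..L}. I l) = {1..n}"

(* The observations with index in J form a function that restrict sets to undefined outside J,
   so the estimation rule T can only use those observations. *)
definition constructed_from_observations ::
    "'o measure \<Rightarrow> (nat \<Rightarrow> 'o \<Rightarrow> 'w) \<Rightarrow> nat set \<Rightarrow> ('o \<Rightarrow> 'c) \<Rightarrow> bool" where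
  "constructed_from_observations M W J est \<longleftrightarrow>
     (\<exists>T. \<forall>\<omega>\<in>space M. est \<omega> = T (restrict (\<lambda>i. W i \<omega>) J))"

definition sample_mean ::
    "(nat \<Rightarrow> 'o \<Rightarrow> 'w) \<Rightarrow> ('w \<Rightarrow> 'v::real_vector) \<Rightarrow> nat \<Rightarrow> 'o \<Rightarrow> 'v" where
  "sample_mean W m n \<omega> = (1 / real n) *\<^sub>R (\<Sum>i=1..n. m (W i \<omega>))"

definition cross_fit_mean ::
    "(nat \<Rightarrow> 'o \<Rightarrow> 'w) \<Rightarrow> nat \<Rightarrow> (nat \<Rightarrow> nat \<Rightarrow> nat set) \<Rightarrow> (nat \<Rightarrow> nat \<Rightarrow> 'o \<Rightarrow> 'c)
      \<Rightarrow> ('w \<Rightarrow> 'c \<Rightarrow> 'v::real_vector) \<Rightarrow> nat \<Rightarrow> 'o \<Rightarrow> 'v" where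
  "cross_fit_mean W L I \<gamma>_hat m n \<omega> =
     (1 / real n) *\<^sub>R (\<Sum>l=1..L. \<Sum>i\<in>I n l. m (W i \<omega>) (\<gamma>_hat n l \<omega>))"

(* measure gives non-measurable sets the value 0, so this notion and the next are meaningful
   only for sequences of random variables. *)
definition tends_to_zero_in_prob ::
    "'o measure \<Rightarrow> (nat \<Rightarrow> 'o \<Rightarrow> 'v::real_normed_vector) \<Rightarrow> bool" where
  "tends_to_zero_in_prob M X \<longleftrightarrow>
     (\<forall>\<epsilon>>0. (\<lambda>n. measure M {\<omega> \<in> space M. norm (X n \<omega>) > \<epsilon>}) \<longlonglongrightarrow> 0)"

(* X = o_p(a) *)
definition is_o_p ::
    "'o measure \<Rightarrow> (nat \<Rightarrow> real) \<Rightarrow> (nat \<Rightarrow> 'o \<Rightarrow> 'v::real_normed_vector) \<Rightarrow> bool" where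
  "is_o_p M a X \<longleftrightarrow> tends_to_zero_in_prob M (\<lambda>n \<omega>. X n \<omega> /\<^sub>R a n)"

(* X = Y + o_p(a) *)
definition eq_up_to_o_p ::
    "'o measure \<Rightarrow> (nat \<Rightarrow> real) \<Rightarrow> (nat \<Rightarrow> 'o \<Rightarrow> 'v::real_normed_vector)
      \<Rightarrow> (nat \<Rightarrow> 'o \<Rightarrow> 'v) \<Rightarrow> bool" where
  "eq_up_to_o_p M a X Y \<longleftrightarrow> is_o_p M a (\<lambda>n \<omega>. X n \<omega> - Y n \<omega>)"

end

theory Submission
  imports Defs
begin

text \<open>Write \<open>s\<close> for the sample mean of \<open>\<psi>\<close> at the true values.
  Averaging over the groups is linear in the moment function (\<open>cross_fit_mean_add\<close>), so
  the hypothesis says that the remainder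
  \<open>R = g_hat \<theta>\<^sub>0 + \<phi>_tilde - s\<close> is o_p of n to the power -1/2. Hence
  \<open>g_hat \<theta>\<^sub>0 - s\<close> and \<open>\<phi>_tilde\<close> add up to a negligible
  sequence, and each of them is \<open>R\<close> minus the other. The equivalence follows because
  negligible sequences are closed under differences (\<open>is_o_p_diff\<close>). That closure rests
  on a union bound for probabilities, which calls for measurable sequences; the remaining lemmas
  supply this measurability.\<close>

lemma tends_to_zero_in_prob_diff:
  fixes X Y :: "nat \<Rightarrow> 'o \<Rightarrow> 'v::{real_normed_vector, second_countable_topology}"
  assumes "finite_measure M"
    and X: "tends_to_zero_in_prob M X" and Y: "tends_to_zero_in_prob M Y"
    and [measurable]: "\<And>n. X n \<in> borel_measurable M" "\<And>n. Y n \<in> borel_measurable M"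
  shows "tends_to_zero_in_prob M (\<lambda>n \<omega>. X n \<omega> - Y n \<omega>)"
  unfolding tends_to_zero_in_prob_def
proof (intro allI impI)
  interpret finite_measure M by fact
  fix \<epsilon> :: real assume "\<epsilon> > 0"
  let ?A = "\<lambda>n. {\<omega> \<in> space M. norm (X n \<omega>) > \<epsilon> / 2}"
  let ?B = "\<lambda>n. {\<omega> \<in> space M. norm (Y n \<omega>) > \<epsilon> / 2}"
  let ?D = "\<lambda>n. {\<omega> \<in> space M. norm (X n \<omega> - Y n \<omega>) > \<epsilon>}"
  \<comment> \<open>If both norms were at most \<epsilon>/2, the triangle inequality would bound the
    norm of the difference by \<epsilon>. Measurability of \<open>X n\<close> and \<open>Y n\<close>
    enters here: \<open>measure\<close> is 0 off the sigma-algebra, so monotonicity and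
    subadditivity require measurable events. Second countability makes the difference Borel.\<close>
  have bound: "measure M (?D n) \<le> measure M (?A n) + measure M (?B n)" for n
  proof -
    have "\<epsilon> / 2 < norm (X n \<omega>) \<or> \<epsilon> / 2 < norm (Y n \<omega>)"
      if "\<epsilon> < norm (X n \<omega> - Y n \<omega>)" for \<omega>
      using that norm_triangle_ineq4[of "X n \<omega>" "Y n \<omega>"] by linarith
    then have "?D n \<subseteq> ?A n \<union> ?B n"
      by blast
    then have "measure M (?D n) \<le> measure M (?A n \<union> ?B n)"
      by (intro finite_measure_mono) measurable
    also have "\<dots> \<le> measure M (?A n) + measure M (?B n)"
      by (intro measure_Un_le) measurable
    finally show ?thesis .
  qed
  have "(\<lambda>n. measure M (?A n)) \<longlonglongrightarrow> 0" "(\<lambda>n. measure M (?B n)) \<longlonglongrightarrow> 0"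
    using X Y half_gt_zero[OF \<open>\<epsilon> > 0\<close>] unfolding tends_to_zero_in_prob_def by blast+
  then have "(\<lambda>n. measure M (?A n) + measure M (?B n)) \<longlonglongrightarrow> 0"
    by (rule tendsto_add_zero)
  \<comment> \<open>Squeeze between the constant 0 and the bound. The rotation puts the limit of the
    upper sequence first, so that the chained fact determines that sequence.\<close>
  then show "(\<lambda>n. measure M (?D n)) \<longlonglongrightarrow> 0"
    by (rule tendsto_sandwich[OF _ _ tendsto_const, rotated 2])
      (intro always_eventually allI bound measure_nonneg)+
qed

text \<open>Rescaling by the inverse of \<open>a n\<close> is linear, so it commutes with
  differences. This includes \<open>a n = 0\<close>, where the inverse is 0 by convention; the rate
  n to the power -1/2 takes that value at n = 0.\<close>

lemma is_o_p_diff: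
  fixes X Y :: "nat \<Rightarrow> 'o \<Rightarrow> 'v::{real_normed_vector, second_countable_topology}"
  assumes "finite_measure M" "is_o_p M a X" "is_o_p M a Y"
    and [measurable]: "\<And>n. X n \<in> borel_measurable M" "\<And>n. Y n \<in> borel_measurable M"
  shows "is_o_p M a (\<lambda>n \<omega>. X n \<omega> - Y n \<omega>)"
  using tends_to_zero_in_prob_diff[of M "\<lambda>n \<omega>. X n \<omega> /\<^sub>R a n" "\<lambda>n \<omega>. Y n \<omega> /\<^sub>R a n"] assms
  by (simp add: is_o_p_def scaleR_diff_right)

lemma cross_fit_mean_add:
  "cross_fit_mean W L I \<gamma>_hat (\<lambda>w \<gamma>. m w \<gamma> + k w \<gamma>) n \<omega> =
   cross_fit_mean W L I \<gamma>_hat m n \<omega> + cross_fit_mean W L I \<gamma>_hat k n \<omega>"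
  by (simp add: cross_fit_mean_def sum.distrib scaleR_add_right)

text \<open>For \<open>n = 0\<close> both means vanish because \<open>1 / 0 = 0\<close>, so measurability of the summands
  is only needed for \<open>n \<ge> 1\<close>.\<close>

lemma borel_measurable_cross_fit_mean:
  fixes m :: "'w \<Rightarrow> 'c \<Rightarrow> 'v::{real_normed_vector, second_countable_topology}"
  assumes "\<And>n l i. n \<ge> 1 \<Longrightarrow> l \<in> {1..L} \<Longrightarrow> i \<in> I n l \<Longrightarrow>
    (\<lambda>\<omega>. m (W i \<omega>) (\<gamma>_hat n l \<omega>)) \<in> borel_measurable M"
  shows "cross_fit_mean W L I \<gamma>_hat m n \<in> borel_measurable M"
proof (cases "n \<ge> 1")
  case True
  then show ?thesis
    unfolding cross_fit_mean_def
    by (intro borel_measurable_scaleR borel_measurable_const borel_measurable_sum assms)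
next
  case False
  then show ?thesis
    by (simp add: cross_fit_mean_def[abs_def] not_le)
qed

lemma borel_measurable_sample_mean:
  fixes m :: "'w \<Rightarrow> 'v::{real_normed_vector, second_countable_topology}"
  assumes "\<And>i. i \<ge> 1 \<Longrightarrow> W i \<in> M \<rightarrow>\<^sub>M S" "m \<in> borel_measurable S"
  shows "sample_mean W m n \<in> borel_measurable M"
  unfolding sample_mean_def using assms
  by (intro borel_measurable_scaleR borel_measurable_const borel_measurable_sum) auto

theorem theorem4:
  fixes M :: "'o measure" and S :: "'w measure"
    and W :: "nat \<Rightarrow> 'o \<Rightarrow> 'w"
    and L :: nat and I :: "nat \<Rightarrow> nat \<Rightarrow> nat set"
    and \<gamma>\<^sub>0 :: "'x \<Rightarrow> 'y" and \<alpha>\<^sub>0 :: "'z \<Rightarrow> 'u" and \<theta>\<^sub>0 :: "'t"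
    and \<gamma>_hat :: "nat \<Rightarrow> nat \<Rightarrow> 'o \<Rightarrow> ('x \<Rightarrow> 'y)"
    and g :: "'w \<Rightarrow> ('x \<Rightarrow> 'y) \<Rightarrow> 't \<Rightarrow> real ^ 'd"
    and \<phi> :: "'w \<Rightarrow> ('x \<Rightarrow> 'y) \<Rightarrow> ('z \<Rightarrow> 'u) \<Rightarrow> 't \<Rightarrow> real ^ 'd"
    and \<psi> :: "'w \<Rightarrow> ('x \<Rightarrow> 'y) \<Rightarrow> ('z \<Rightarrow> 'u) \<Rightarrow> 't \<Rightarrow> real ^ 'd"
    and g_hat :: "'t \<Rightarrow> nat \<Rightarrow> 'o \<Rightarrow> real ^ 'd"
    and \<phi>_tilde :: "nat \<Rightarrow> 'o \<Rightarrow> real ^ 'd"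
  assumes prob: "prob_space M"
    and iid: "iid_observations M S W"
    and groups: "\<And>n. n \<ge> 1 \<Longrightarrow> partition_into_groups n L (I n)"
    and estimator: "\<And>n l. n \<ge> 1 \<Longrightarrow> l \<in> {1..L} \<Longrightarrow>
          constructed_from_observations M W ({1..n} - I n l) (\<gamma>_hat n l)"
    and g_meas: "(\<lambda>w. g w \<gamma>\<^sub>0 \<theta>\<^sub>0) \<in> borel_measurable S"
    and \<phi>_meas: "(\<lambda>w. \<phi> w \<gamma>\<^sub>0 \<alpha>\<^sub>0 \<theta>\<^sub>0) \<in> borel_measurable S"
    and g_hat_meas: "\<And>n l i. n \<ge> 1 \<Longrightarrow> l \<in> {1..L} \<Longrightarrow> i \<in> I n l \<Longrightarrow>
          (\<lambda>\<omega>. g (W i \<omega>) (\<gamma>_hat n l \<omega>) \<theta>\<^sub>0) \<in> borel_measurable M"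
    and \<phi>_hat_meas: "\<And>n l i. n \<ge> 1 \<Longrightarrow> l \<in> {1..L} \<Longrightarrow> i \<in> I n l \<Longrightarrow>
          (\<lambda>\<omega>. \<phi> (W i \<omega>) (\<gamma>_hat n l \<omega>) \<alpha>\<^sub>0 \<theta>\<^sub>0) \<in> borel_measurable M"
    and \<psi>: "\<And>w \<gamma> \<alpha> \<theta>. \<psi> w \<gamma> \<alpha> \<theta> = g w \<gamma> \<theta> + \<phi> w \<gamma> \<alpha> \<theta>"
    and g_hat: "\<And>\<theta>. g_hat \<theta> = cross_fit_mean W L I \<gamma>_hat (\<lambda>w \<gamma>. g w \<gamma> \<theta>)"
    and \<phi>_tilde: "\<phi>_tilde = cross_fit_mean W L I \<gamma>_hat (\<lambda>w \<gamma>. \<phi> w \<gamma> \<alpha>\<^sub>0 \<theta>\<^sub>0)"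
    and expansion: "eq_up_to_o_p M (\<lambda>n. real n powr (-1/2))
          (cross_fit_mean W L I \<gamma>_hat (\<lambda>w \<gamma>. g w \<gamma> \<theta>\<^sub>0 + \<phi> w \<gamma> \<alpha>\<^sub>0 \<theta>\<^sub>0))
          (sample_mean W (\<lambda>w. \<psi> w \<gamma>\<^sub>0 \<alpha>\<^sub>0 \<theta>\<^sub>0))"
  shows "eq_up_to_o_p M (\<lambda>n. real n powr (-1/2)) (g_hat \<theta>\<^sub>0)
           (sample_mean W (\<lambda>w. \<psi> w \<gamma>\<^sub>0 \<alpha>\<^sub>0 \<theta>\<^sub>0))
         \<longleftrightarrow> is_o_p M (\<lambda>n. real n powr (-1/2)) \<phi>_tilde"
proof -
  interpret prob_space M by (rule prob)
  define a where "a = (\<lambda>n. real n powr (-1/2))"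
  define s where "s = sample_mean W (\<lambda>w. \<psi> w \<gamma>\<^sub>0 \<alpha>\<^sub>0 \<theta>\<^sub>0)"
  define R where "R = (\<lambda>n \<omega>. g_hat \<theta>\<^sub>0 n \<omega> + \<phi>_tilde n \<omega> - s n \<omega>)"
  \<comment> \<open>Independence in the sense of \<open>indep_vars\<close> includes measurability of
    each observation.\<close>
  have W: "W i \<in> M \<rightarrow>\<^sub>M S" if "i \<ge> 1" for i
    using iid that by (auto simp: iid_observations_def indep_vars_def)
  have [measurable]: "s n \<in> borel_measurable M" for n
    unfolding s_def \<psi>
    by (intro borel_measurable_sample_mean[where S = S] W borel_measurable_add g_meas \<phi>_meas)
  have [measurable]: "g_hat \<theta>\<^sub>0 n \<in> borel_measurable M" for n
    unfolding g_hat by (intro borel_measurable_cross_fit_mean g_hat_meas)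
  have [measurable]: "\<phi>_tilde n \<in> borel_measurable M" for n
    unfolding \<phi>_tilde by (intro borel_measurable_cross_fit_mean \<phi>_hat_meas)
  have [measurable]: "R n \<in> borel_measurable M" for n
    unfolding R_def by measurable
  \<comment> \<open>Splitting the joint mean of the two moment functions turns the assumed expansion
    into negligibility of \<open>R\<close>.\<close>
  have R: "is_o_p M a R"
    using expansion
    by (simp add: eq_up_to_o_p_def cross_fit_mean_add R_def a_def s_def g_hat \<phi>_tilde)
  have "is_o_p M a (\<lambda>n \<omega>. g_hat \<theta>\<^sub>0 n \<omega> - s n \<omega>) \<longleftrightarrow> is_o_p M a \<phi>_tilde"
  proof
    assume "is_o_p M a (\<lambda>n \<omega>. g_hat \<theta>\<^sub>0 n \<omega> - s n \<omega>)"
    \<comment> \<open>The sequence on the right is \<open>\<phi>_tilde\<close>: both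
      \<open>g_hat \<theta>\<^sub>0\<close> and \<open>s\<close> cancel.\<close>
    with R have "is_o_p M a (\<lambda>n \<omega>. R n \<omega> - (g_hat \<theta>\<^sub>0 n \<omega> - s n \<omega>))"
      by (rule is_o_p_diff[OF finite_measure_axioms]) measurable
    then show "is_o_p M a \<phi>_tilde"
      by (simp add: R_def)
  next
    assume "is_o_p M a \<phi>_tilde"
    \<comment> \<open>Here \<open>\<phi>_tilde\<close> cancels and
      \<open>g_hat \<theta>\<^sub>0 - s\<close> is left.\<close>
    with R have "is_o_p M a (\<lambda>n \<omega>. R n \<omega> - \<phi>_tilde n \<omega>)"
      by (rule is_o_p_diff[OF finite_measure_axioms]) measurable
    then show "is_o_p M a (\<lambda>n \<omega>. g_hat \<theta>\<^sub>0 n \<omega> - s n \<omega>)"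
      by (simp add: R_def algebra_simps)
  qed
  then show ?thesis
    by (simp add: eq_up_to_o_p_def a_def s_def)
qed

end
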